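(* Let $U_{n,m}$ be a uni-cyclic graph (a finite simple connected graph on $n$ vertices containing exactly one cycle, which has length $m\le n$), and let $\Delta_s(U_{n,m})$ be its spanning simplicial complex. Then $\dim(\Delta_s(U_{n,m}))=n-2$, and the $f$-vector $f(\Delta_s(U_{n,m}))=(f_0,f_1,\ldots,f_{n-2})$ is given by $$f_i=\begin{cases}\binom{n}{i+1}, & \text{for } i\le m-2,\\[4pt] \binom{n}{i+1}-\binom{n-m}{i-m+1}, & \text{for } m-2<i\le n-2.\end{cases}$$
   Context: A spanning tree of a finite simple connected graph $G(V,E)$ is a subtree of $G$ containing every vertex of $G$; $s(G)$ is the collection of all edge sets of spanning trees of $G$. The spanning simplicial complex $\Delta_s(G)$ is the simplicial complex on the vertex set $E$ (the edges of $G$) whose facets are precisely the elements of $s(G)$. A uni-cyclic graph $U_{n,m}$ has exactly $n$ edges. The dimension of a face $F$ is $|F|-1$, the dimension of a simplicial complex is the maximal dimension of its faces, and the $f$-vector of a simplicial complex of dimension $d$ is $(f_0,\ldots,f_d)$, where $f_i$ is the number of $i$-dimensional faces. *)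

theory Defs
  imports Complex_Main
begin

record 'a sgraph =
  verts :: "'a set"
  edges :: "'a set set"

definition finite_simple_graph :: "'a sgraph \<Rightarrow> bool" where
  "finite_simple_graph G \<longleftrightarrow> finite (verts G) \<and> (\<forall>e\<in>edges G. e \<subseteq> verts G \<and> card e = 2)"

definition adjacent :: "'a sgraph \<Rightarrow> 'a \<Rightarrow> 'a \<Rightarrow> bool" where
  "adjacent G u v \<longleftrightarrow> {u, v} \<in> edges G"

definition connected_graph :: "'a sgraph \<Rightarrow> bool" where
  "connected_graph G \<longleftrightarrow>
     verts G \<noteq> {} \<and> (\<forall>u\<in>verts G. \<forall>v\<in>verts G. (adjacent G)\<^sup>*\<^sup>* u v)"

definition cyclic_edges :: "'a list \<Rightarrow> 'a set set" where
  "cyclic_edges vs = {{vs ! i, vs ! (Suc i mod length vs)} |i. i < length vs}"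

text \<open>
  A cycle is a subgraph, not a closed walk: it has no base point and no orientation.  It is
  determined by its edge set, which represents it here; its length is the cardinality of that set.
\<close>

definition cycles :: "'a sgraph \<Rightarrow> 'a set set set" where
  "cycles G = {cyclic_edges vs |vs. distinct vs \<and> 3 \<le> length vs \<and> cyclic_edges vs \<subseteq> edges G}"

definition unicyclic_graph :: "'a sgraph \<Rightarrow> nat \<Rightarrow> nat \<Rightarrow> bool" where
  "unicyclic_graph G n m \<longleftrightarrow>
     finite_simple_graph G \<and> connected_graph G \<and> card (verts G) = n \<and>
     (\<exists>C. cycles G = {C} \<and> card C = m) \<and> m \<le> n"

definition tree :: "'a sgraph \<Rightarrow> bool" where
  "tree G \<longleftrightarrow> finite_simple_graph G \<and> connected_graph G \<and> cycles G = {}"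

definition subgraph :: "'a sgraph \<Rightarrow> 'a sgraph \<Rightarrow> bool" where
  "subgraph H G \<longleftrightarrow> verts H \<subseteq> verts G \<and> edges H \<subseteq> edges G"

definition spanning_tree :: "'a sgraph \<Rightarrow> 'a sgraph \<Rightarrow> bool" where
  "spanning_tree H G \<longleftrightarrow> subgraph H G \<and> tree H \<and> verts H = verts G"

definition spanning_tree_edge_sets :: "'a sgraph \<Rightarrow> 'a set set set" where
  "spanning_tree_edge_sets G = {edges H |H. spanning_tree H G}"

definition facets :: "'b set set \<Rightarrow> 'b set set" where
  "facets \<Delta> = {F \<in> \<Delta>. \<forall>F'\<in>\<Delta>. F \<subseteq> F' \<longrightarrow> F' = F}"

text \<open>
  The complex generated by the edge sets of the spanning trees.  The lemma
  \<open>spanning_complex_iff\<close> below shows that it is the unique simplicial complex of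
  sets of edges whose facets are precisely these edge sets.
\<close>

definition spanning_complex :: "'a sgraph \<Rightarrow> 'a set set set" where
  "spanning_complex G = {F. \<exists>T\<in>spanning_tree_edge_sets G. F \<subseteq> T}"

text \<open>Integer-valued, since the empty face has dimension \<open>-1\<close>.\<close>

definition face_dim :: "'b set \<Rightarrow> int" where
  "face_dim F = int (card F) - 1"

definition complex_dim :: "'b set set \<Rightarrow> int" where
  "complex_dim \<Delta> = Max (face_dim ` \<Delta>)"

definition f_number :: "'b set set \<Rightarrow> nat \<Rightarrow> nat" where
  "f_number \<Delta> i = card {F \<in> \<Delta>. face_dim F = int i}"

definition f_vector :: "'b set set \<Rightarrow> nat list" where
  "f_vector \<Delta> = map (f_number \<Delta>) [0..<nat (complex_dim \<Delta> + 1)]"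

lemma rtranclp_distinct_path:
  assumes "r\<^sup>*\<^sup>* u v"
  shows "\<exists>vs. vs \<noteq> [] \<and> distinct vs \<and> hd vs = u \<and> last vs = v \<and> successively r vs"
  using assms
proof (induction rule: converse_rtranclp_induct)
  case base
  show ?case by (rule exI[of _ "[v]"]) simp
next
  case (step u w)
  then obtain vs where vs: "vs \<noteq> []" "distinct vs" "hd vs = w" "last vs = v" "successively r vs"
    by blast
  show ?case
  proof (cases "u \<in> set vs")
    case True
    then obtain xs ys where "vs = xs @ u # ys" by (meson split_list)
    with vs show ?thesis
      by (intro exI[of _ "u # ys"]) (auto simp: successively_append_iff)
  next
    case False
    with vs step.hyps(1) show ?thesis
      by (intro exI[of _ "u # vs"]) (auto simp: successively_Cons)
  qed
qed

lemma spanning_tree_edge_sets_antichain: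
  assumes T: "T \<in> spanning_tree_edge_sets G" and T': "T' \<in> spanning_tree_edge_sets G"
    and "T \<subseteq> T'"
  shows "T = T'"
proof (rule ccontr)
  assume "T \<noteq> T'"
  with \<open>T \<subseteq> T'\<close> obtain e where e: "e \<in> T'" "e \<notin> T" by blast
  from T obtain H where H: "T = edges H" "tree H" "verts H = verts G"
    by (auto simp: spanning_tree_edge_sets_def spanning_tree_def)
  from T' obtain H' where H': "T' = edges H'" "tree H'" "verts H' = verts G"
    by (auto simp: spanning_tree_edge_sets_def spanning_tree_def)
  from e(1) H' have "e \<subseteq> verts G" "card e = 2"
    by (auto simp: tree_def finite_simple_graph_def)
  then obtain u v where uv: "e = {u, v}" "u \<noteq> v" "u \<in> verts G" "v \<in> verts G"
    by (metis card_2_iff insert_subset)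
  with H have "(adjacent H)\<^sup>*\<^sup>* u v"
    by (auto simp: tree_def connected_graph_def)
  from rtranclp_distinct_path[OF this]
  obtain vs where vs: "vs \<noteq> []" "distinct vs" "hd vs = u" "last vs = v"
    "successively (adjacent H) vs"
    by blast
  have len: "3 \<le> length vs"
  proof (rule ccontr)
    assume "\<not> 3 \<le> length vs"
    with vs(1) consider a where "vs = [a]" | a b where "vs = [a, b]"
      by (cases vs rule: remdups_adj.cases) (auto simp: Suc_le_eq)
    then show False
      using vs(3-5) uv(1,2) e(2) H(1) by cases (auto simp: adjacent_def)
  qed
  have "cyclic_edges vs \<subseteq> edges H'"
  proof
    fix d assume "d \<in> cyclic_edges vs"
    then obtain i where i: "d = {vs ! i, vs ! (Suc i mod length vs)}" "i < length vs"
      by (auto simp: cyclic_edges_def)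
    show "d \<in> edges H'"
    proof (cases "Suc i < length vs")
      case True
      with vs(5) have "adjacent H (vs ! i) (vs ! Suc i)"
        by (auto simp: successively_conv_nth)
      with True i \<open>T \<subseteq> T'\<close> H(1) H'(1) show ?thesis
        by (auto simp: adjacent_def)
    next
      case False
      with i(2) have "Suc i = length vs" by simp
      then have "d = {last vs, hd vs}"
        using i(1) vs(1) by (metis diff_Suc_1 hd_conv_nth last_conv_nth mod_self)
      with vs uv(1) e(1) H'(1) show ?thesis
        by (simp add: insert_commute)
    qed
  qed
  with vs(2) len have "cyclic_edges vs \<in> cycles H'"
    by (auto simp: cycles_def)
  with H'(2) show False
    by (simp add: tree_def)
qed

lemma spanning_complex_iff:
  assumes "finite_simple_graph G"
  shows "\<Delta> \<subseteq> Pow (edges G) \<and> (\<forall>F\<in>\<Delta>. \<forall>F'. F' \<subseteq> F \<longrightarrow> F' \<in> \<Delta>) \<and>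
      facets \<Delta> = spanning_tree_edge_sets G \<longleftrightarrow> \<Delta> = spanning_complex G"
    (is "?L \<longleftrightarrow> ?R")
proof
  assume L: ?L
  have "edges G \<subseteq> Pow (verts G)" "finite (verts G)"
    using assms by (auto simp: finite_simple_graph_def)
  then have "finite (edges G)"
    by (meson finite_Pow_iff finite_subset)
  with L have fin: "finite \<Delta>"
    by (meson finite_Pow_iff finite_subset)
  have "\<exists>T\<in>facets \<Delta>. F \<subseteq> T" if "F \<in> \<Delta>" for F
  proof -
    from finite_has_maximal2[OF fin that] obtain T
      where "T \<in> \<Delta>" "F \<subseteq> T" "\<forall>F'\<in>\<Delta>. T \<subseteq> F' \<longrightarrow> T = F'"
      by auto
    then show ?thesis by (auto simp: facets_def)
  qed
  then have "\<Delta> \<subseteq> spanning_complex G"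
    using L by (auto simp: spanning_complex_def)
  moreover have "spanning_complex G \<subseteq> \<Delta>"
  proof
    fix F assume "F \<in> spanning_complex G"
    then obtain T where "T \<in> facets \<Delta>" "F \<subseteq> T"
      using L by (auto simp: spanning_complex_def)
    then have "T \<in> \<Delta>" by (simp add: facets_def)
    with \<open>F \<subseteq> T\<close> L show "F \<in> \<Delta>" by blast
  qed
  ultimately show ?R by blast
next
  assume R: ?R
  have sub: "T \<subseteq> edges G" if "T \<in> spanning_tree_edge_sets G" for T
    using that by (auto simp: spanning_tree_edge_sets_def spanning_tree_def subgraph_def)
  have "facets \<Delta> = spanning_tree_edge_sets G"
  proof (intro equalityI subsetI)
    fix T assume "T \<in> facets \<Delta>"
    then obtain T' where "T' \<in> spanning_tree_edge_sets G" "T \<subseteq> T'"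
      "\<forall>F'\<in>spanning_complex G. T \<subseteq> F' \<longrightarrow> F' = T"
      by (auto simp: R facets_def spanning_complex_def)
    moreover from this have "T' \<in> spanning_complex G"
      by (auto simp: spanning_complex_def)
    ultimately show "T \<in> spanning_tree_edge_sets G" by metis
  next
    fix T assume T: "T \<in> spanning_tree_edge_sets G"
    have "F' = T" if "F' \<in> spanning_complex G" "T \<subseteq> F'" for F'
    proof -
      from that obtain T' where "T' \<in> spanning_tree_edge_sets G" "F' \<subseteq> T'"
        by (auto simp: spanning_complex_def)
      with T that(2) spanning_tree_edge_sets_antichain[of T G T'] show ?thesis by blast
    qed
    with T show "T \<in> facets \<Delta>"
      by (auto simp: R facets_def spanning_complex_def)
  qed
  moreover have "\<Delta> \<subseteq> Pow (edges G)"
    using sub by (auto simp: R spanning_complex_def)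
  moreover have "\<forall>F\<in>\<Delta>. \<forall>F'. F' \<subseteq> F \<longrightarrow> F' \<in> \<Delta>"
    unfolding R spanning_complex_def by blast
  ultimately show ?L by blast
qed

end

theory Submission
  imports Defs
begin

text \<open>
  Deleting any edge of the unique cycle \<open>C\<close> leaves a spanning tree, and every spanning tree misses
  an edge of \<open>C\<close>; hence the faces are exactly the edge sets that do not contain \<open>C\<close>.  A tree on
  \<open>n\<close> vertices has \<open>n - 1\<close> edges, so the graph has \<open>n\<close> edges, and the \<open>f\<close>-vector counts the
  \<open>(i + 1)\<close>-subsets of \<open>n\<close> edges, minus those containing \<open>C\<close>.
\<close>

section \<open>Basic facts on adjacency, edges and cycles\<close>

lemma adjacent_sym: "adjacent G u v \<longleftrightarrow> adjacent G v u"
  by (simp add: adjacent_def insert_commute)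

lemma rtranclp_adjacent_sym:
  assumes "(adjacent G)\<^sup>*\<^sup>* u v"
  shows "(adjacent G)\<^sup>*\<^sup>* v u"
proof -
  have "symp (adjacent G)"
    by (auto intro: sympI simp: adjacent_sym)
  then show ?thesis
    using assms by (metis symp_rtranclp sympD)
qed

lemma adjacent_verts:
  assumes "finite_simple_graph G" "adjacent G u v"
  shows "u \<in> verts G" "v \<in> verts G"
  using assms by (auto simp: finite_simple_graph_def adjacent_def)

lemma finite_edges:
  assumes "finite_simple_graph G"
  shows "finite (edges G)"
proof (rule finite_subset)
  show "edges G \<subseteq> Pow (verts G)" "finite (Pow (verts G))"
    using assms by (auto simp: finite_simple_graph_def)
qed

lemma cyclesE:
  assumes "C \<in> cycles G"
  obtains vs where "C = cyclic_edges vs" "distinct vs" "3 \<le> length vs" "C \<subseteq> edges G"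
  using assms by (auto simp: cycles_def)

lemma cycles_mono: "edges H \<subseteq> edges G \<Longrightarrow> cycles H \<subseteq> cycles G"
  by (auto simp: cycles_def)

section \<open>Edge count of a tree\<close>

text \<open>
  The edges from each vertex to a neighbour closer to a fixed root form a spanning tree, which by
  the antichain property of spanning trees is all of the tree.
\<close>

lemma tree_card_verts:
  assumes "tree G"
  shows "card (verts G) = Suc (card (edges G))"
proof -
  have fsg: "finite_simple_graph G" and conn: "connected_graph G" and acyc: "cycles G = {}"
    using assms by (auto simp: tree_def)
  have fin: "finite (verts G)"
    using fsg by (simp add: finite_simple_graph_def)
  obtain r where r: "r \<in> verts G"
    using conn by (auto simp: connected_graph_def)
  \<comment> \<open>\<open>d v\<close> is the distance from the root: the length of a shortest walk
    from \<open>r\<close> to \<open>v\<close>.\<close>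
  define d where "d v = (LEAST k. (adjacent G ^^ k) r v)" for v
  have "\<exists>u. adjacent G v u \<and> d u < d v" if v: "v \<in> verts G - {r}" for v
  proof -
    have "(adjacent G)\<^sup>*\<^sup>* r v"
      using conn r v by (auto simp: connected_graph_def)
    then have "\<exists>k. (adjacent G ^^ k) r v"
      by (meson rtranclp_imp_relpowp)
    then have walk: "(adjacent G ^^ d v) r v"
      unfolding d_def by (rule LeastI_ex)
    \<comment> \<open>A walk of length 0 would give \<open>v = r\<close>. So the walk has a last
      edge, and its other end \<open>u\<close> is reached in \<open>j\<close> steps.\<close>
    with v obtain j where j: "d v = Suc j"
      by (cases "d v") auto
    with walk obtain u where u: "(adjacent G ^^ j) r u" "adjacent G u v"
      by auto
    have "d u \<le> j"
      unfolding d_def by (rule Least_le) (rule u(1))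
    with u j show ?thesis
      by (auto simp: adjacent_sym)
  qed
  then obtain p where p: "\<And>v. v \<in> verts G - {r} \<Longrightarrow> adjacent G v (p v) \<and> d (p v) < d v"
    by metis
  define P where "P = (\<lambda>v. {v, p v}) ` (verts G - {r})"
  have inj: "inj_on (\<lambda>v. {v, p v}) (verts G - {r})"
  proof (rule inj_onI)
    fix v w assume v: "v \<in> verts G - {r}" and w: "w \<in> verts G - {r}" and "{v, p v} = {w, p w}"
    then consider "v = w" | "v = p w" "p v = w"
      by (auto simp: doubleton_eq_iff)
    \<comment> \<open>If \<open>v\<close> and \<open>w\<close> were parents of each other, each
      would be strictly closer to the root than the other.\<close>
    then show "v = w"
      using p[OF v] p[OF w] by cases auto
  qed
  define H where "H = \<lparr>verts = verts G, edges = P\<rparr>"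
  have sub: "edges H \<subseteq> edges G"
    using p by (auto simp: H_def P_def adjacent_def)
  \<comment> \<open>Following parents lowers the distance, so the walk ends at
    \<open>r\<close>.\<close>
  have to_root: "(adjacent H)\<^sup>*\<^sup>* v r" if "v \<in> verts G" for v
    using that
  proof (induction "d v" arbitrary: v rule: less_induct)
    case less
    show ?case
    proof (cases "v = r")
      case False
      with less.prems have v: "v \<in> verts G - {r}" by simp
      have "p v \<in> verts G"
        using p[OF v] adjacent_verts[OF fsg] by blast
      with less.hyps p[OF v] have "(adjacent H)\<^sup>*\<^sup>* (p v) r" by blast
      moreover have "adjacent H v (p v)"
        using v by (auto simp: adjacent_def H_def P_def)
      ultimately show ?thesis
        by (rule converse_rtranclp_into_rtranclp[rotated])
    qed simp
  qed
  have "(adjacent H)\<^sup>*\<^sup>* u v" if "u \<in> verts G" "v \<in> verts G" for u v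
    using to_root[OF that(1)] rtranclp_adjacent_sym[OF to_root[OF that(2)]]
    by (rule rtranclp_trans)
  then have "connected_graph H"
    using r by (auto simp: connected_graph_def H_def)
  moreover have "finite_simple_graph H"
    using fsg sub by (auto simp: finite_simple_graph_def H_def)
  ultimately have "spanning_tree H G"
    using sub acyc cycles_mono[OF sub]
    by (auto simp: spanning_tree_def subgraph_def tree_def H_def)
  moreover have "spanning_tree G G"
    using assms by (simp add: spanning_tree_def subgraph_def)
  ultimately have "edges H = edges G"
    using spanning_tree_edge_sets_antichain sub
    by (metis (mono_tags, lifting) mem_Collect_eq spanning_tree_edge_sets_def)
  then have "edges G = P"
    by (simp add: H_def)
  then have "card (edges G) = card (verts G - {r})"
    using inj by (simp add: P_def card_image)
  with r fin show ?thesis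
    by (metis card_Suc_Diff1)
qed

section \<open>Deleting an edge of a cycle\<close>

text \<open>Equal edges at different positions would make each position the cyclic successor of the
  other, so two steps would go round the whole cycle; length at least 3 excludes this.\<close>

lemma inj_on_cyclic_edge:
  assumes "distinct vs" "3 \<le> length vs"
  shows "inj_on (\<lambda>i. {vs ! i, vs ! (Suc i mod length vs)}) {..<length vs}"
proof (rule inj_onI)
  fix i j
  assume i: "i \<in> {..<length vs}" and j: "j \<in> {..<length vs}"
    and eq: "{vs ! i, vs ! (Suc i mod length vs)} = {vs ! j, vs ! (Suc j mod length vs)}"
  have "Suc k mod length vs < length vs" for k
    using assms(2) by (intro mod_less_divisor) auto
  then consider "i = j" | "i = Suc j mod length vs" "Suc i mod length vs = j"
    using i j eq assms(1) by (auto simp: doubleton_eq_iff nth_eq_iff_index_eq)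
  then show "i = j"
    using assms(2) i j by cases (auto simp: mod_Suc split: if_splits)
qed

lemma card_cyclic_edges:
  assumes "distinct vs" "3 \<le> length vs"
  shows "card (cyclic_edges vs) = length vs"
proof -
  have "cyclic_edges vs = (\<lambda>i. {vs ! i, vs ! (Suc i mod length vs)}) ` {..<length vs}"
    by (auto simp: cyclic_edges_def)
  then show ?thesis
    using card_image[OF inj_on_cyclic_edge[OF assms]] by simp
qed

text \<open>The rest of the cycle joins the ends of the edge the other way round, and it never uses
  that edge, since each edge sits at only one position.\<close>

lemma cyclic_edges_detour:
  assumes "distinct vs" "3 \<le> length vs" "cyclic_edges vs - {{u, v}} \<subseteq> edges H"
    and "{u, v} \<in> cyclic_edges vs"
  shows "(adjacent H)\<^sup>*\<^sup>* u v"
proof -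
  let ?L = "length vs"
  obtain i where i: "i < ?L" "{u, v} = {vs ! i, vs ! (Suc i mod ?L)}"
    using assms(4) by (auto simp: cyclic_edges_def)
  have walk: "(adjacent H)\<^sup>*\<^sup>* (vs ! (Suc i mod ?L)) (vs ! ((Suc i + j) mod ?L))" if "j < ?L" for j
    using that
  proof (induction j)
    case (Suc j)
    let ?k = "(Suc i + j) mod ?L"
    have k: "?k < ?L" "Suc ?k mod ?L = (Suc i + Suc j) mod ?L"
      using mod_less_divisor[of ?L "Suc i + j"] i(1) by (linarith, simp add: mod_Suc_eq)
    \<comment> \<open>From \<open>Suc i\<close>, position \<open>i\<close> is first reached after
      \<open>?L - 1\<close> steps, and \<open>j < ?L - 1\<close> here.\<close>
    have "?k \<noteq> i"
      using Suc.prems i(1) by (auto simp: mod_if split: if_splits)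
    then have "{vs ! ?k, vs ! (Suc ?k mod ?L)} \<noteq> {u, v}"
      using inj_onD[OF inj_on_cyclic_edge[OF assms(1,2)], of ?k i] k(1) i by auto
    moreover have "{vs ! ?k, vs ! (Suc ?k mod ?L)} \<in> cyclic_edges vs"
      using k(1) unfolding cyclic_edges_def by blast
    ultimately have "adjacent H (vs ! ?k) (vs ! (Suc ?k mod ?L))"
      using assms(3) unfolding adjacent_def by blast
    with Suc show ?case
      unfolding k(2) by (auto intro: rtranclp.rtrancl_into_rtrancl)
  qed simp
  have "(Suc i + (?L - 1)) mod ?L = i"
    using i(1) assms(2) by (auto simp: mod_if)
  with walk[of "?L - 1"] i(1) have "(adjacent H)\<^sup>*\<^sup>* (vs ! (Suc i mod ?L)) (vs ! i)"
    by simp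
  \<comment> \<open>The equation of unordered pairs does not say which end is \<open>u\<close>, so
    both directions are supplied.\<close>
  moreover from this have "(adjacent H)\<^sup>*\<^sup>* (vs ! i) (vs ! (Suc i mod ?L))"
    by (rule rtranclp_adjacent_sym)
  ultimately show ?thesis
    using i(2) by (auto simp: doubleton_eq_iff)
qed

text \<open>In any walk of \<open>G\<close>, each passage along \<open>e\<close> can be replaced by
  the detour round the rest of \<open>C\<close>.\<close>

lemma connected_graph_delete_cycle_edge:
  assumes "connected_graph G" "C \<in> cycles G" "e \<in> C"
  shows "connected_graph (G\<lparr>edges := edges G - {e}\<rparr>)" (is "connected_graph ?H")
proof -
  obtain vs where vs: "C = cyclic_edges vs" "distinct vs" "3 \<le> length vs" "C \<subseteq> edges G"
    using assms(2) by (rule cyclesE)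
  have step: "(adjacent ?H)\<^sup>*\<^sup>* u v" if "adjacent G u v" for u v
  proof (cases "{u, v} = e")
    case True
    with vs assms(3) show ?thesis
      by (intro cyclic_edges_detour[of vs]) auto
  next
    case False
    with that show ?thesis
      by (intro r_into_rtranclp) (simp add: adjacent_def)
  qed
  have "(adjacent ?H)\<^sup>*\<^sup>* u v" if "(adjacent G)\<^sup>*\<^sup>* u v" for u v
    using that by (induction rule: rtranclp_induct) (auto dest: step intro: rtranclp_trans)
  then show ?thesis
    using assms(1) by (auto simp: connected_graph_def)
qed

text \<open>Deleting \<open>e\<close> creates no new cycle and destroys \<open>C\<close>, the only
  one there was, while connectedness survives.\<close>

lemma spanning_tree_delete_cycle_edge:
  assumes "finite_simple_graph G" "connected_graph G" "cycles G = {C}" "e \<in> C"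
  shows "spanning_tree (G\<lparr>edges := edges G - {e}\<rparr>) G" (is "spanning_tree ?H G")
proof -
  have "cycles ?H \<subseteq> {C}"
    using cycles_mono[of ?H G] assms(3) by auto
  moreover have "C \<notin> cycles ?H"
    using assms(4) by (auto simp: cycles_def)
  ultimately have "cycles ?H = {}" by blast
  moreover have "connected_graph ?H"
    using assms by (intro connected_graph_delete_cycle_edge) auto
  ultimately show ?thesis
    using assms(1) by (auto simp: spanning_tree_def subgraph_def tree_def finite_simple_graph_def)
qed

section \<open>Faces and edge count in the unicyclic case\<close>

lemma spanning_complex_unicyclic:
  assumes "finite_simple_graph G" "connected_graph G" "cycles G = {C}"
  shows "spanning_complex G = {F. F \<subseteq> edges G \<and> \<not> C \<subseteq> F}"
proof (intro equalityI subsetI)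
  fix F assume "F \<in> spanning_complex G"
  then obtain H where H: "spanning_tree H G" "F \<subseteq> edges H"
    by (auto simp: spanning_complex_def spanning_tree_edge_sets_def)
  have "\<not> C \<subseteq> edges H"
  proof
    assume "C \<subseteq> edges H"
    moreover have "C \<in> cycles G"
      using assms(3) by simp
    ultimately have "C \<in> cycles H"
      by (auto simp: cycles_def)
    with H(1) show False
      by (simp add: spanning_tree_def tree_def)
  qed
  with H show "F \<in> {F. F \<subseteq> edges G \<and> \<not> C \<subseteq> F}"
    by (auto simp: spanning_tree_def subgraph_def)
next
  fix F assume "F \<in> {F. F \<subseteq> edges G \<and> \<not> C \<subseteq> F}"
  \<comment> \<open>An edge of \<open>C\<close> missing from \<open>F\<close>: the spanning tree
    obtained by deleting it still contains \<open>F\<close>.\<close>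
  then obtain e where e: "e \<in> C" "F \<subseteq> edges G - {e}" by blast
  have "edges (G\<lparr>edges := edges G - {e}\<rparr>) \<in> spanning_tree_edge_sets G"
    using spanning_tree_delete_cycle_edge[OF assms e(1)]
    unfolding spanning_tree_edge_sets_def by blast
  with e(2) show "F \<in> spanning_complex G"
    by (auto simp: spanning_complex_def)
qed

lemma card_edges_unicyclic:
  assumes "finite_simple_graph G" "connected_graph G" "cycles G = {C}"
  shows "card (edges G) = card (verts G)"
proof -
  obtain vs where vs: "C = cyclic_edges vs" "distinct vs" "3 \<le> length vs" "C \<subseteq> edges G"
    using cyclesE[of C G] assms(3) by auto
  \<comment> \<open>\<open>C\<close> has as many edges as its vertex list has entries, hence at
    least 3, so it is nonempty.\<close>
  then obtain e where e: "e \<in> C"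
    using card_cyclic_edges[of vs] by fastforce
  have "card (verts G) = Suc (card (edges G - {e}))"
    using tree_card_verts[of "G\<lparr>edges := edges G - {e}\<rparr>"]
      spanning_tree_delete_cycle_edge[OF assms e]
    by (simp add: spanning_tree_def)
  then show ?thesis
    using card_Suc_Diff1[OF finite_edges[OF assms(1)]] e vs(4) by auto
qed

section \<open>Counting the subsets that do or do not contain a given set\<close>

text \<open>Removing \<open>C\<close> is a bijection onto the subsets of \<open>E - C\<close> of
  size \<open>k - card C\<close>, with inverse adding \<open>C\<close> back.\<close>

lemma n_supersets:
  assumes "finite E" "C \<subseteq> E" "card C \<le> k"
  shows "card {F. F \<subseteq> E \<and> C \<subseteq> F \<and> card F = k} = (card E - card C) choose (k - card C)"
proof -
  have finC: "finite C"
    using assms finite_subset by blast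
  have "bij_betw (\<lambda>F. F - C) {F. F \<subseteq> E \<and> C \<subseteq> F \<and> card F = k}
      {B. B \<subseteq> E - C \<and> card B = k - card C}"
  proof (rule bij_betw_byWitness[where f' = "\<lambda>B. B \<union> C"])
    show "(\<lambda>B. B \<union> C) ` {B. B \<subseteq> E - C \<and> card B = k - card C}
        \<subseteq> {F. F \<subseteq> E \<and> C \<subseteq> F \<and> card F = k}"
    proof clarify
      fix B assume B: "B \<subseteq> E - C" "card B = k - card C"
      then have "card (B \<union> C) = card B + card C"
        using assms(1) finC by (intro card_Un_disjoint) (auto intro: finite_subset)
      with B assms show "B \<union> C \<subseteq> E \<and> C \<subseteq> B \<union> C \<and> card (B \<union> C) = k"
        by auto
    qed
  qed (use finC in \<open>auto simp: card_Diff_subset\<close>)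
  then have "card {F. F \<subseteq> E \<and> C \<subseteq> F \<and> card F = k} = card {B. B \<subseteq> E - C \<and> card B = k - card C}"
    by (rule bij_betw_same_card)
  also have "\<dots> = card (E - C) choose (k - card C)"
    using assms(1) by (intro n_subsets) simp
  finally show ?thesis
    using finC assms(2) by (simp add: card_Diff_subset)
qed

text \<open>A set smaller than \<open>C\<close> cannot contain it; for larger \<open>k\<close> the
  supersets of \<open>C\<close> are subtracted from all \<open>k\<close>-subsets. Over the integers
  the difference is not truncated.\<close>

lemma n_subsets_not_superset:
  assumes "finite E" "C \<subseteq> E"
  shows "int (card {F. F \<subseteq> E \<and> \<not> C \<subseteq> F \<and> card F = k}) =
    (if k < card C then int (card E choose k)
     else int (card E choose k) - int ((card E - card C) choose (k - card C)))"
proof -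
  have card_all: "card {F. F \<subseteq> E \<and> card F = k} = card E choose k"
    using assms(1) by (rule n_subsets)
  show ?thesis
  proof (cases "k < card C")
    case True
    then have "\<not> C \<subseteq> F" if "F \<subseteq> E" "card F = k" for F
      using that assms(1) card_mono[of F C] finite_subset by fastforce
    then have "{F. F \<subseteq> E \<and> \<not> C \<subseteq> F \<and> card F = k} = {F. F \<subseteq> E \<and> card F = k}"
      by auto
    with True card_all show ?thesis by simp
  next
    case False
    let ?A = "{F. F \<subseteq> E \<and> card F = k}" and ?B = "{F. F \<subseteq> E \<and> C \<subseteq> F \<and> card F = k}"
    have eq: "{F. F \<subseteq> E \<and> \<not> C \<subseteq> F \<and> card F = k} = ?A - ?B"
      by auto
    have finA: "finite ?A"
      using assms(1) by simp
    have BA: "?B \<subseteq> ?A"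
      by auto
    have "int (card {F. F \<subseteq> E \<and> \<not> C \<subseteq> F \<and> card F = k}) = int (card ?A) - int (card ?B)"
      unfolding eq card_Diff_subset[OF finite_subset[OF BA finA] BA]
      using card_mono[OF finA BA] by (rule of_nat_diff)
    with False show ?thesis
      using card_all n_supersets[OF assms, of k] by simp
  qed
qed

section \<open>Dimension and f-vector\<close>

theorem proposition3p3:
  fixes G :: "'a sgraph" and n m :: nat
  assumes "unicyclic_graph G n m"
  shows "complex_dim (spanning_complex G) = int n - 2 \<and>
    length (f_vector (spanning_complex G)) = n - 1 \<and>
    (\<forall>i. i \<le> n - 2 \<longrightarrow>
      int (f_vector (spanning_complex G) ! i) =
        (if i \<le> m - 2 then int (n choose (i + 1))
         else int (n choose (i + 1)) - int ((n - m) choose (i + 1 - m))))"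
proof -
  obtain C where G: "finite_simple_graph G" "connected_graph G" "cycles G = {C}"
    and n: "card (verts G) = n" and m: "card C = m" "m \<le> n"
    using assms by (auto simp: unicyclic_graph_def)
  obtain vs where vs: "C = cyclic_edges vs" "distinct vs" "3 \<le> length vs" and sub: "C \<subseteq> edges G"
    using cyclesE[of C G] G(3) by auto
  \<comment> \<open>Together with \<open>m \<le> n\<close> this makes the natural-number differences
    \<open>m - 2\<close>, \<open>n - 1\<close> and \<open>n - 2\<close> exact.\<close>
  have m3: "3 \<le> m"
    using card_cyclic_edges[of vs] vs m(1) by simp
  have fin: "finite (edges G)"
    using G(1) by (rule finite_edges)
  have cardE: "card (edges G) = n"
    using card_edges_unicyclic[OF G] n by simp
  note complex = spanning_complex_unicyclic[OF G]
  have dim: "complex_dim (spanning_complex G) = int n - 2"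
    unfolding complex_dim_def
  proof (rule Max_eqI)
    show "finite (face_dim ` spanning_complex G)"
      unfolding complex using fin by simp
  next
    fix x assume "x \<in> face_dim ` spanning_complex G"
    then obtain F where F: "x = int (card F) - 1" "F \<subseteq> edges G" "\<not> C \<subseteq> F"
      by (auto simp: complex face_dim_def)
    \<comment> \<open>A face misses an edge of \<open>C\<close>, so it has at most
      \<open>n - 1\<close> edges.\<close>
    with sub have "F \<subset> edges G" by blast
    with fin have "card F < n"
      using psubset_card_mono cardE by blast
    with F(1) show "x \<le> int n - 2" by simp
  next
    \<comment> \<open>The bound is attained by all edges but one of \<open>C\<close>.\<close>
    from m3 m(1) obtain e where e: "e \<in> C" by fastforce
    then have "card (edges G - {e}) = n - 1"
      using sub fin cardE by auto
    then have "face_dim (edges G - {e}) = int n - 2"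
      using m m3 by (simp add: face_dim_def)
    moreover have "edges G - {e} \<in> spanning_complex G"
      using e by (auto simp: complex)
    ultimately show "int n - 2 \<in> face_dim ` spanning_complex G"
      by (metis image_eqI)
  qed
  have len: "nat (complex_dim (spanning_complex G) + 1) = n - 1"
    using dim m(2) m3 by simp
  have "int (f_vector (spanning_complex G) ! i) =
        (if i \<le> m - 2 then int (n choose (i + 1))
         else int (n choose (i + 1)) - int ((n - m) choose (i + 1 - m)))" if "i \<le> n - 2" for i
  proof -
    have "i < n - 1"
      using that m(2) m3 by simp
    then have "f_vector (spanning_complex G) ! i = f_number (spanning_complex G) i"
      by (simp add: f_vector_def len)
    \<comment> \<open>Dimension \<open>i\<close> means \<open>i + 1\<close> edges, so the count is
      applied with \<open>k = i + 1\<close>.\<close>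
    moreover have "{F \<in> spanning_complex G. face_dim F = int i} =
        {F. F \<subseteq> edges G \<and> \<not> C \<subseteq> F \<and> card F = i + 1}"
      by (auto simp: complex face_dim_def)
    moreover have "i + 1 < m \<longleftrightarrow> i \<le> m - 2"
      using m3 by auto
    ultimately show ?thesis
      using n_subsets_not_superset[OF fin sub, of "i + 1"]
      by (simp add: f_number_def cardE m(1))
  qed
  with dim len show ?thesis
    by (simp add: f_vector_def)
qed

end
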